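(* Let $R\neq\mathbb F_2$ be a unique factorization domain and let $M$ be a free $R$-module. Then $M\nrightarrow(1)^{\mathrm{Span}}_2$: there is a colouring $c:M\to\{0,1\}$ such that for no nonzero $x\in M$ is $c$ constant on $Rx\setminus\{0\}$. (Consequently, for no nonzero submodule $N\subseteq M$ is $c$ constant on $N\setminus\{0\}$.)
   Context: A unique factorization domain is a commutative ring with unit and without zero divisors in which every nonzero non-unit element factors as a product of irreducible elements, uniquely up to order and associates. $\mathbb F_2$ is the field with two elements. *)

theory Defs
  imports "HOL-Algebra.Algebra"
begin

definition spans_module ::
  "('a, 'm) ring_scheme \<Rightarrow> ('a, 'b, 'n) module_scheme \<Rightarrow> 'b set \<Rightarrow> bool" where
  "spans_module R M B \<longleftrightarrow>
     (\<forall>x \<in> carrier M. \<exists>A a. finite A \<and> A \<subseteq> B \<and> a \<in> A \<rightarrow> carrier R \<and>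
        x = (\<Oplus>\<^bsub>M\<^esub> b \<in> A. a b \<odot>\<^bsub>M\<^esub> b))"

definition independent_in_module ::
  "('a, 'm) ring_scheme \<Rightarrow> ('a, 'b, 'n) module_scheme \<Rightarrow> 'b set \<Rightarrow> bool" where
  "independent_in_module R M B \<longleftrightarrow>
     (\<forall>A a. finite A \<and> A \<subseteq> B \<and> a \<in> A \<rightarrow> carrier R \<and>
        (\<Oplus>\<^bsub>M\<^esub> b \<in> A. a b \<odot>\<^bsub>M\<^esub> b) = \<zero>\<^bsub>M\<^esub> \<longrightarrow> (\<forall>b \<in> A. a b = \<zero>\<^bsub>R\<^esub>))"

text \<open>The basis may be infinite, or empty (for the zero module).\<close>

definition free_module :: "('a, 'm) ring_scheme \<Rightarrow> ('a, 'b, 'n) module_scheme \<Rightarrow> bool" where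
  "free_module R M \<longleftrightarrow>
     module R M \<and>
     (\<exists>B. B \<subseteq> carrier M \<and> spans_module R M B \<and> independent_in_module R M B)"

text \<open>The zero vector is left out of \<open>S\<close>, as monochromaticity only concerns nonzero vectors.\<close>

definition monochromatic_off_zero ::
  "('a, 'b, 'n) module_scheme \<Rightarrow> ('b \<Rightarrow> nat) \<Rightarrow> 'b set \<Rightarrow> bool" where
  "monochromatic_off_zero M c S \<longleftrightarrow> (\<exists>k. \<forall>y \<in> S - {\<zero>\<^bsub>M\<^esub>}. c y = k)"

end

theory Submission
  imports Defs
begin

text \<open>
  If \<open>R\<close> has a nonzero non-unit \<open>p\<close>, colour \<open>x\<close> by the parity of the exponent of the largest power
  of \<open>p\<close> dividing \<open>x\<close>. This exponent exists because \<open>R\<close> has no infinite chains of proper divisors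
  and divisibility can be read off the coordinates of \<open>x\<close>, and it increases by one from \<open>x\<close> to
  \<open>p x\<close>. Otherwise \<open>R\<close> is a field with at least three elements; then colour one nonzero vector of
  each line by 0 and all others by 1.
\<close>

section \<open>Recognising the two-element field\<close>

text \<open>Parity gives a surjective homomorphism from the integers with kernel generated by 2, so
  the first isomorphism theorem applies. Used in contrapositive form: a domain that is not a copy of
  \<open>ZFact 2\<close> has an element other than 0 and 1.\<close>

lemma ZFact_2_iso:
  assumes "domain R" and R: "carrier R = {\<zero>\<^bsub>R\<^esub>, \<one>\<^bsub>R\<^esub>}"
  shows "R \<simeq> ZFact 2"
proof -
  interpret domain R by fact
  \<comment> \<open>Equality here would cancel to 1 = 0. With only two elements available, 1 + 1
    must then be 0, which makes the parity map \<open>h\<close> additive.\<close>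
  have "\<one>\<^bsub>R\<^esub> \<oplus>\<^bsub>R\<^esub> \<one>\<^bsub>R\<^esub> \<noteq> \<one>\<^bsub>R\<^esub>"
    using R by (metis add.l_cancel_one' one_closed one_not_zero)
  then have two: "\<one>\<^bsub>R\<^esub> \<oplus>\<^bsub>R\<^esub> \<one>\<^bsub>R\<^esub> = \<zero>\<^bsub>R\<^esub>"
    using R by (metis add.m_closed insert_iff one_closed singletonD)
  define h :: "int \<Rightarrow> _" where "h n = (if even n then \<zero>\<^bsub>R\<^esub> else \<one>\<^bsub>R\<^esub>)" for n
  have hom: "ring_hom_ring \<Z> R h"
  proof (rule ring_hom_ringI)
    show "ring \<Z>" by (rule int.ring_axioms)
    show "ring R" by (rule ring_axioms)
  qed (auto simp: h_def two)
  have "h ` carrier \<Z> \<subseteq> {\<zero>\<^bsub>R\<^esub>, \<one>\<^bsub>R\<^esub>}"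
    by (auto simp: h_def)
  moreover have "\<zero>\<^bsub>R\<^esub> \<in> h ` carrier \<Z>" "\<one>\<^bsub>R\<^esub> \<in> h ` carrier \<Z>"
    using imageI[of 0 "carrier \<Z>" h] imageI[of 1 "carrier \<Z>" h] by (simp_all add: h_def)
  ultimately have surj: "h ` carrier \<Z> = carrier R"
    unfolding R by (intro subset_antisym) simp_all
  have ker: "a_kernel \<Z> R h = Idl\<^bsub>\<Z>\<^esub> {2}"
    unfolding int_Idl by (auto simp: a_kernel_def' h_def split: if_splits elim!: evenE)
  have "ZFact 2 \<simeq> R"
    using ring_hom_ring.FactRing_iso[OF hom surj] by (simp add: ker ZFact_def)
  then show ?thesis
    using ring_iso_sym cring.axioms(1)[OF ZFact_is_cring] by blast
qed

section \<open>Powers of a non-unit dividing a ring element\<close>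

text \<open>Well-founded induction on proper divisors: cancelling one factor \<open>p\<close> from
  \<open>a\<close> leaves a proper divisor of \<open>a\<close>, and a bound for it, raised by one,
  is a bound for \<open>a\<close>.\<close>

lemma (in factorial_domain) power_not_divides:
  assumes p: "p \<in> carrier R - {\<zero>}" "p \<notin> Units R" and a: "a \<in> carrier R - {\<zero>}"
  shows "\<exists>n::nat. \<not> (p [^] n) divides a"
  using division_wellfounded a
proof (induction a rule: wf_induct_rule)
  case (less a)
  show ?case
  proof (cases "p divides a")
    case False
    then have "\<not> (p [^] (1::nat)) divides a"
      using p by simp
    then show ?thesis ..
  next
    case True
    then obtain b where b: "b \<in> carrier R" "a = p \<otimes> b"
      by (auto simp: factor_def)
    \<comment> \<open>The induction lives in \<open>mult_of R\<close>, the monoid of nonzero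
      elements, so the cofactor must be shown to belong to it. It is a proper factor because
      \<open>p\<close> is not a unit.\<close>
    have b0: "b \<noteq> \<zero>"
      using b less.prems p by auto
    have "properfactor (mult_of R) b a"
      by (rule mult_of.properfactorI3[of a b p]) (use b b0 p less.prems m_comm in auto)
    then obtain n :: nat where n: "\<not> (p [^] n) divides b"
      using less b b0 by auto
    have "\<not> (p [^] Suc n) divides a"
    proof
      assume "(p [^] Suc n) divides a"
      then obtain c where c: "c \<in> carrier R" "a = p [^] Suc n \<otimes> c"
        by (auto simp: factor_def)
      then have "p \<otimes> b = p \<otimes> (p [^] n \<otimes> c)"
        using b p c by (simp add: m_ac)
      then have "b = p [^] n \<otimes> c"
        using b p c m_lcancel by auto
      then show False
        using n c by (auto simp: factor_def)
    qed
    then show ?thesis ..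
  qed
qed

section \<open>Finite linear combinations\<close>

text \<open>Padding with zero coefficients lets two combinations with different supports be compared
  over one common finite set.\<close>

lemma (in module) combination_extend:
  assumes "finite C" "A \<subseteq> C" "C \<subseteq> carrier M" "a \<in> A \<rightarrow> carrier R"
  shows "(\<Oplus>\<^bsub>M\<^esub> b \<in> A. a b \<odot>\<^bsub>M\<^esub> b) = (\<Oplus>\<^bsub>M\<^esub> b \<in> C. (if b \<in> A then a b else \<zero>) \<odot>\<^bsub>M\<^esub> b)"
proof -
  let ?a = "\<lambda>b. if b \<in> A then a b else \<zero>"
  show ?thesis
  proof (rule M.add.finprod_mono_neutral_cong_left[where h = "\<lambda>b. ?a b \<odot>\<^bsub>M\<^esub> b"])
    show "?a b \<odot>\<^bsub>M\<^esub> b = \<zero>\<^bsub>M\<^esub>" if "b \<in> C - A" for b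
      using that assms(3) by auto
    show "a b \<odot>\<^bsub>M\<^esub> b = ?a b \<odot>\<^bsub>M\<^esub> b" if "b \<in> A" for b
      using that by simp
    show "(\<lambda>b. ?a b \<odot>\<^bsub>M\<^esub> b) \<in> C \<rightarrow> carrier M"
      using assms by (auto simp: Pi_iff subset_iff)
  qed (fact assms)+
qed

lemma (in module) combination_diff:
  assumes "finite C" "C \<subseteq> carrier M" "a \<in> C \<rightarrow> carrier R" "d \<in> C \<rightarrow> carrier R"
  shows "(\<Oplus>\<^bsub>M\<^esub> b \<in> C. (a b \<ominus> d b) \<odot>\<^bsub>M\<^esub> b) =
    (\<Oplus>\<^bsub>M\<^esub> b \<in> C. a b \<odot>\<^bsub>M\<^esub> b) \<ominus>\<^bsub>M\<^esub> (\<Oplus>\<^bsub>M\<^esub> b \<in> C. d b \<odot>\<^bsub>M\<^esub> b)"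
proof -
  \<comment> \<open>The subtracted combination is added back first, so that additivity of finite
    sums suffices; it is moved to the other side at the end.\<close>
  have "(\<Oplus>\<^bsub>M\<^esub> b \<in> C. (a b \<ominus> d b) \<odot>\<^bsub>M\<^esub> b) \<oplus>\<^bsub>M\<^esub> (\<Oplus>\<^bsub>M\<^esub> b \<in> C. d b \<odot>\<^bsub>M\<^esub> b) =
    (\<Oplus>\<^bsub>M\<^esub> b \<in> C. (a b \<ominus> d b) \<odot>\<^bsub>M\<^esub> b \<oplus>\<^bsub>M\<^esub> d b \<odot>\<^bsub>M\<^esub> b)"
    using assms by (intro M.finsum_addf[symmetric]) (auto simp: Pi_iff subset_iff)
  also have "\<dots> = (\<Oplus>\<^bsub>M\<^esub> b \<in> C. a b \<odot>\<^bsub>M\<^esub> b)"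
  proof (intro M.finsum_cong' refl)
    fix b assume "b \<in> C"
    then have "a b \<in> carrier R" "d b \<in> carrier R" "b \<in> carrier M"
      using assms by auto
    moreover from this have "a b \<ominus> d b \<oplus> d b = a b"
      by (simp add: R.minus_eq R.add.m_assoc R.l_neg)
    ultimately show "(a b \<ominus> d b) \<odot>\<^bsub>M\<^esub> b \<oplus>\<^bsub>M\<^esub> d b \<odot>\<^bsub>M\<^esub> b = a b \<odot>\<^bsub>M\<^esub> b"
      by (metis R.minus_closed smult_l_distr)
  qed (use assms in \<open>auto simp: Pi_iff subset_iff\<close>)
  finally have "(\<Oplus>\<^bsub>M\<^esub> b \<in> C. (a b \<ominus> d b) \<odot>\<^bsub>M\<^esub> b) \<oplus>\<^bsub>M\<^esub> (\<Oplus>\<^bsub>M\<^esub> b \<in> C. d b \<odot>\<^bsub>M\<^esub> b) =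
    (\<Oplus>\<^bsub>M\<^esub> b \<in> C. a b \<odot>\<^bsub>M\<^esub> b)" .
  moreover have "(\<Oplus>\<^bsub>M\<^esub> b \<in> C. (a b \<ominus> d b) \<odot>\<^bsub>M\<^esub> b) \<in> carrier M"
    "(\<Oplus>\<^bsub>M\<^esub> b \<in> C. d b \<odot>\<^bsub>M\<^esub> b) \<in> carrier M"
    using assms by (auto intro!: M.finsum_closed simp: Pi_iff subset_iff)
  moreover have "(\<Oplus>\<^bsub>M\<^esub> b \<in> C. a b \<odot>\<^bsub>M\<^esub> b) \<in> carrier M"
    using assms by (auto intro!: M.finsum_closed simp: Pi_iff subset_iff)
  ultimately show ?thesis
    unfolding M.minus_eq by (subst M.add.inv_solve_right) simp_all
qed

lemma (in module) smult_combination: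
  assumes "finite A" "A \<subseteq> carrier M" "a \<in> A \<rightarrow> carrier R" "s \<in> carrier R"
  shows "s \<odot>\<^bsub>M\<^esub> (\<Oplus>\<^bsub>M\<^esub> b \<in> A. a b \<odot>\<^bsub>M\<^esub> b) = (\<Oplus>\<^bsub>M\<^esub> b \<in> A. (s \<otimes> a b) \<odot>\<^bsub>M\<^esub> b)"
proof -
  have "s \<odot>\<^bsub>M\<^esub> (\<Oplus>\<^bsub>M\<^esub> b \<in> A. a b \<odot>\<^bsub>M\<^esub> b) = (\<Oplus>\<^bsub>M\<^esub> b \<in> A. s \<odot>\<^bsub>M\<^esub> (a b \<odot>\<^bsub>M\<^esub> b))"
    using assms by (intro finsum_smult_ldistr) (auto simp: Pi_iff subset_iff)
  also have "\<dots> = (\<Oplus>\<^bsub>M\<^esub> b \<in> A. (s \<otimes> a b) \<odot>\<^bsub>M\<^esub> b)"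
    using assms by (intro M.finsum_cong') (auto simp: Pi_iff subset_iff smult_assoc1)
  finally show ?thesis .
qed

section \<open>Coordinates and torsion-freeness\<close>

text \<open>Any nonzero coordinate of \<open>x\<close> in a basis serves as \<open>r\<close>, since
  coordinates are unique and scale with the vector. Questions about divisibility and torsion in
  \<open>M\<close> thereby become questions about a single nonzero ring element.\<close>

lemma free_module_nonzero_coefficient:
  assumes "free_module R M" and x: "x \<in> carrier M - {\<zero>\<^bsub>M\<^esub>}"
  shows "\<exists>r \<in> carrier R - {\<zero>\<^bsub>R\<^esub>}.
    (\<forall>s \<in> carrier R. \<forall>y \<in> carrier M. x = s \<odot>\<^bsub>M\<^esub> y \<longrightarrow> s divides\<^bsub>R\<^esub> r) \<and>
    (\<forall>s \<in> carrier R. s \<odot>\<^bsub>M\<^esub> x = \<zero>\<^bsub>M\<^esub> \<longrightarrow> s \<otimes>\<^bsub>R\<^esub> r = \<zero>\<^bsub>R\<^esub>)"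
proof -
  obtain B where B: "B \<subseteq> carrier M" "spans_module R M B" "independent_in_module R M B"
    and "module R M"
    using assms by (auto simp: free_module_def)
  then interpret module R M by simp
  obtain A a where A: "finite A" "A \<subseteq> B" "a \<in> A \<rightarrow> carrier R"
    and xa: "x = (\<Oplus>\<^bsub>M\<^esub> b \<in> A. a b \<odot>\<^bsub>M\<^esub> b)"
    using B x by (auto simp: spans_module_def)
  have "\<exists>b\<in>A. a b \<noteq> \<zero>\<^bsub>R\<^esub>"
  proof (rule ccontr)
    assume "\<not> ?thesis"
    then have "x = (\<Oplus>\<^bsub>M\<^esub> b \<in> A. \<zero>\<^bsub>M\<^esub>)"
      unfolding xa using A B by (intro M.finsum_cong') auto
    then show False
      using x by simp
  qed
  then obtain b0 where b0: "b0 \<in> A" "a b0 \<noteq> \<zero>\<^bsub>R\<^esub>"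
    by blast
  show ?thesis
  proof (intro bexI[of _ "a b0"] conjI ballI impI)
    show "a b0 \<in> carrier R - {\<zero>\<^bsub>R\<^esub>}"
      using b0 A by auto
  next
    fix s assume s: "s \<in> carrier R" "s \<odot>\<^bsub>M\<^esub> x = \<zero>\<^bsub>M\<^esub>"
    then have "(\<Oplus>\<^bsub>M\<^esub> b \<in> A. (s \<otimes>\<^bsub>R\<^esub> a b) \<odot>\<^bsub>M\<^esub> b) = \<zero>\<^bsub>M\<^esub>"
      using smult_combination[of A a s] A B xa by auto
    moreover have "(\<lambda>b. s \<otimes>\<^bsub>R\<^esub> a b) \<in> A \<rightarrow> carrier R"
      using A s by auto
    ultimately show "s \<otimes>\<^bsub>R\<^esub> a b0 = \<zero>\<^bsub>R\<^esub>"
      using B(3) A b0 unfolding independent_in_module_def by blast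
  next
    fix s y assume s: "s \<in> carrier R" and y: "y \<in> carrier M" and xy: "x = s \<odot>\<^bsub>M\<^esub> y"
    obtain D d where D: "finite D" "D \<subseteq> B" "d \<in> D \<rightarrow> carrier R"
      and yd: "y = (\<Oplus>\<^bsub>M\<^esub> b \<in> D. d b \<odot>\<^bsub>M\<^esub> b)"
      using B y by (auto simp: spans_module_def)
    \<comment> \<open>The expansions of \<open>x\<close> and \<open>y\<close> may use different
      basis vectors. Over the union of the supports both have coefficients everywhere, so it does
      not matter whether \<open>b0\<close> occurs in the expansion of \<open>y\<close>.\<close>
    define C where "C = A \<union> D"
    define a' where "a' b = (if b \<in> A then a b else \<zero>\<^bsub>R\<^esub>)" for b
    define d' where "d' b = (if b \<in> D then d b else \<zero>\<^bsub>R\<^esub>)" for b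
    have C: "finite C" "C \<subseteq> B" "C \<subseteq> carrier M"
      using A D B by (auto simp: C_def)
    have a': "a' \<in> C \<rightarrow> carrier R" and d': "d' \<in> C \<rightarrow> carrier R"
      using A D by (auto simp: a'_def d'_def)
    have sd': "(\<lambda>b. s \<otimes>\<^bsub>R\<^esub> d' b) \<in> C \<rightarrow> carrier R"
      using d' s by auto
    have xa': "x = (\<Oplus>\<^bsub>M\<^esub> b \<in> C. a' b \<odot>\<^bsub>M\<^esub> b)"
      unfolding xa a'_def using A C by (intro combination_extend) (auto simp: C_def)
    have "y = (\<Oplus>\<^bsub>M\<^esub> b \<in> C. d' b \<odot>\<^bsub>M\<^esub> b)"
      unfolding yd d'_def using D C by (intro combination_extend) (auto simp: C_def)
    then have "x = (\<Oplus>\<^bsub>M\<^esub> b \<in> C. (s \<otimes>\<^bsub>R\<^esub> d' b) \<odot>\<^bsub>M\<^esub> b)"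
      using smult_combination[OF C(1,3) d' s] xy by simp
    \<comment> \<open>Subtracting the two expansions of \<open>x\<close> gives a relation among
      basis vectors; independence then equates the coefficients at \<open>b0\<close>.\<close>
    then have "(\<Oplus>\<^bsub>M\<^esub> b \<in> C. (a' b \<ominus>\<^bsub>R\<^esub> s \<otimes>\<^bsub>R\<^esub> d' b) \<odot>\<^bsub>M\<^esub> b) = \<zero>\<^bsub>M\<^esub>"
      using combination_diff[OF C(1,3) a' sd'] xa' x by (simp add: M.minus_eq M.r_neg)
    moreover have "(\<lambda>b. a' b \<ominus>\<^bsub>R\<^esub> s \<otimes>\<^bsub>R\<^esub> d' b) \<in> C \<rightarrow> carrier R"
      using a' sd' by (auto simp: Pi_iff)
    moreover have "b0 \<in> C"
      using b0 by (simp add: C_def)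
    ultimately have "a' b0 \<ominus>\<^bsub>R\<^esub> s \<otimes>\<^bsub>R\<^esub> d' b0 = \<zero>\<^bsub>R\<^esub>"
      using B(3) C unfolding independent_in_module_def by blast
    then have "a b0 = s \<otimes>\<^bsub>R\<^esub> d' b0" "d' b0 \<in> carrier R"
      using a' d' sd' \<open>b0 \<in> C\<close> b0 by (auto simp: a'_def Pi_iff R.r_right_minus_eq)
    then show "s divides\<^bsub>R\<^esub> a b0"
      by (auto simp: factor_def)
  qed
qed

text \<open>A scalar killing a nonzero \<open>x\<close> also kills a nonzero coordinate of
  \<open>x\<close>, and a domain has no zero divisors.\<close>

lemma free_module_torsion_free:
  assumes "domain R" "free_module R M" "x \<in> carrier M" "s \<in> carrier R" "s \<odot>\<^bsub>M\<^esub> x = \<zero>\<^bsub>M\<^esub>"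
  shows "s = \<zero>\<^bsub>R\<^esub> \<or> x = \<zero>\<^bsub>M\<^esub>"
proof -
  interpret domain R by fact
  show ?thesis
  proof (rule disjCI)
    assume "x \<noteq> \<zero>\<^bsub>M\<^esub>"
    then have "x \<in> carrier M - {\<zero>\<^bsub>M\<^esub>}"
      using assms(3) by simp
    then obtain r where r: "r \<in> carrier R - {\<zero>\<^bsub>R\<^esub>}"
      and ann: "\<forall>s \<in> carrier R. s \<odot>\<^bsub>M\<^esub> x = \<zero>\<^bsub>M\<^esub> \<longrightarrow> s \<otimes>\<^bsub>R\<^esub> r = \<zero>\<^bsub>R\<^esub>"
      using free_module_nonzero_coefficient[OF assms(2)] by blast
    have "s \<otimes>\<^bsub>R\<^esub> r = \<zero>\<^bsub>R\<^esub>"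
      using ann assms(4,5) by blast
    then show "s = \<zero>\<^bsub>R\<^esub>"
      using r assms(4) by (simp add: integral_iff)
  qed
qed

lemma free_module_smult_cancel:
  assumes "domain R" and free: "free_module R M" and xy: "x \<in> carrier M" "y \<in> carrier M"
    and s: "s \<in> carrier R - {\<zero>\<^bsub>R\<^esub>}" and eq: "s \<odot>\<^bsub>M\<^esub> x = s \<odot>\<^bsub>M\<^esub> y"
  shows "x = y"
proof -
  interpret module R M using free by (simp add: free_module_def)
  have "s \<odot>\<^bsub>M\<^esub> (x \<ominus>\<^bsub>M\<^esub> y) = \<zero>\<^bsub>M\<^esub>"
    using xy s eq by (simp add: M.minus_eq smult_r_distr smult_r_minus M.r_neg)
  then have "x \<ominus>\<^bsub>M\<^esub> y = \<zero>\<^bsub>M\<^esub>"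
    using free_module_torsion_free[OF assms(1,2), of "x \<ominus>\<^bsub>M\<^esub> y" s] xy s by auto
  then have "x \<oplus>\<^bsub>M\<^esub> \<ominus>\<^bsub>M\<^esub> y = \<zero>\<^bsub>M\<^esub>"
    by (simp add: M.minus_eq)
  then show ?thesis
    using M.add.inv_solve_right'[of "\<zero>\<^bsub>M\<^esub>" x y] xy by simp
qed

section \<open>Colouring by divisibility exponents\<close>

text \<open>The scalars 1 and \<open>p\<close> already give every nonzero \<open>x\<close> two
  multiples of different parity, because multiplication by \<open>p\<close> raises \<open>c\<close>
  by exactly one.\<close>

lemma coloring_of_nonunit:
  assumes "factorial_domain R" and free: "free_module R M"
    and p: "p \<in> carrier R - {\<zero>\<^bsub>R\<^esub>}" "p \<notin> Units R"
  shows "\<exists>c. \<forall>x \<in> carrier M - {\<zero>\<^bsub>M\<^esub>}. even (c (p \<odot>\<^bsub>M\<^esub> x) :: nat) \<noteq> even (c x)"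
proof -
  interpret R: factorial_domain R by fact
  interpret module R M using free by (simp add: free_module_def)
  \<comment> \<open>Divisibility of \<open>x\<close> by the \<open>n\<close>-th power of
    \<open>p\<close> inside the module.\<close>
  define D where "D n x \<longleftrightarrow> (\<exists>y \<in> carrier M. x = (p [^]\<^bsub>R\<^esub> n) \<odot>\<^bsub>M\<^esub> y)" for n :: nat and x
  have step: "D (Suc n) (p \<odot>\<^bsub>M\<^esub> x) \<longleftrightarrow> D n x" if x: "x \<in> carrier M" for n x
  proof -
    have "p \<odot>\<^bsub>M\<^esub> x = (p [^]\<^bsub>R\<^esub> Suc n) \<odot>\<^bsub>M\<^esub> y \<longleftrightarrow> x = (p [^]\<^bsub>R\<^esub> n) \<odot>\<^bsub>M\<^esub> y" if y: "y \<in> carrier M" for y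
    proof -
      have "(p [^]\<^bsub>R\<^esub> Suc n) \<odot>\<^bsub>M\<^esub> y = p \<odot>\<^bsub>M\<^esub> ((p [^]\<^bsub>R\<^esub> n) \<odot>\<^bsub>M\<^esub> y)"
        using p y by (simp add: R.m_comm smult_assoc1[symmetric])
      then show ?thesis
        using free_module_smult_cancel[OF R.domain_axioms free x _ p(1), of "(p [^]\<^bsub>R\<^esub> n) \<odot>\<^bsub>M\<^esub> y"] p y
        by auto
    qed
    then show ?thesis
      by (auto simp: D_def)
  qed
  \<comment> \<open>Every power of \<open>p\<close> dividing \<open>x\<close> divides its nonzero
    coordinate \<open>r\<close>, and only boundedly many powers do.\<close>
  have ex: "\<exists>n. \<not> D n x" if x: "x \<in> carrier M - {\<zero>\<^bsub>M\<^esub>}" for x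
  proof -
    obtain r where r: "r \<in> carrier R - {\<zero>\<^bsub>R\<^esub>}"
      "\<forall>s \<in> carrier R. \<forall>y \<in> carrier M. x = s \<odot>\<^bsub>M\<^esub> y \<longrightarrow> s divides\<^bsub>R\<^esub> r"
      using free_module_nonzero_coefficient[OF free x] by blast
    obtain n :: nat where "\<not> (p [^]\<^bsub>R\<^esub> n) divides\<^bsub>R\<^esub> r"
      using R.power_not_divides[OF p r(1)] by blast
    then have "\<not> D n x"
      using r(2) p by (auto simp: D_def)
    then show ?thesis ..
  qed
  \<comment> \<open>This is one more than the largest exponent. The shift is harmless, since only
    the change of parity from \<open>x\<close> to \<open>p x\<close> matters.\<close>
  define c where "c x = (LEAST n. \<not> D n x)" for x
  have "c (p \<odot>\<^bsub>M\<^esub> x) = Suc (c x)" if x: "x \<in> carrier M - {\<zero>\<^bsub>M\<^esub>}" for x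
  proof -
    obtain n where "\<not> D n x"
      using ex[OF x] by blast
    then have "\<not> D (Suc n) (p \<odot>\<^bsub>M\<^esub> x)"
      using step x by simp
    \<comment> \<open>\<open>Least_Suc\<close> needs the predicate to fail at 0; it does, because
      the zeroth power of \<open>p\<close> is 1.\<close>
    moreover have "D 0 (p \<odot>\<^bsub>M\<^esub> x)"
      using x p by (auto simp: D_def intro!: bexI[of _ "p \<odot>\<^bsub>M\<^esub> x"])
    ultimately have "c (p \<odot>\<^bsub>M\<^esub> x) = Suc (LEAST n. \<not> D (Suc n) (p \<odot>\<^bsub>M\<^esub> x))"
      unfolding c_def by (intro Least_Suc) auto
    then show ?thesis
      using x step by (simp add: c_def)
  qed
  then show ?thesis
    by (intro exI[of _ c]) simp
qed

section \<open>Colouring by representatives of lines\<close>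

text \<open>Each line with the origin removed contains its chosen representative and, because there
  is a scalar other than 0 and 1, at least one further vector.\<close>

lemma coloring_of_field:
  assumes "domain R" and free: "free_module R M"
    and units: "carrier R - {\<zero>\<^bsub>R\<^esub>} \<subseteq> Units R" and not2: "\<not> R \<simeq> ZFact 2"
  shows "\<exists>P. \<forall>x \<in> carrier M - {\<zero>\<^bsub>M\<^esub>}.
    \<exists>r \<in> carrier R - {\<zero>\<^bsub>R\<^esub>}. \<exists>s \<in> carrier R - {\<zero>\<^bsub>R\<^esub>}. P (r \<odot>\<^bsub>M\<^esub> x) \<and> \<not> P (s \<odot>\<^bsub>M\<^esub> x)"
proof -
  interpret R: domain R by fact
  interpret module R M using free by (simp add: free_module_def)
  obtain t where t: "t \<in> carrier R" "t \<noteq> \<zero>\<^bsub>R\<^esub>" "t \<noteq> \<one>\<^bsub>R\<^esub>"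
    using ZFact_2_iso[OF assms(1)] not2 by auto
  define L where "L x = {r \<odot>\<^bsub>M\<^esub> x | r. r \<in> carrier R - {\<zero>\<^bsub>R\<^esub>}}" for x
  have L_sub: "L (r \<odot>\<^bsub>M\<^esub> x) \<subseteq> L x" if "x \<in> carrier M" "r \<in> carrier R - {\<zero>\<^bsub>R\<^esub>}" for r x
  proof
    fix z assume "z \<in> L (r \<odot>\<^bsub>M\<^esub> x)"
    then obtain q where q: "q \<in> carrier R - {\<zero>\<^bsub>R\<^esub>}" "z = q \<odot>\<^bsub>M\<^esub> (r \<odot>\<^bsub>M\<^esub> x)"
      by (auto simp: L_def)
    then have "z = (q \<otimes>\<^bsub>R\<^esub> r) \<odot>\<^bsub>M\<^esub> x" "q \<otimes>\<^bsub>R\<^esub> r \<in> carrier R - {\<zero>\<^bsub>R\<^esub>}"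
      using that by (auto simp: smult_assoc1 R.integral_iff)
    then show "z \<in> L x"
      by (auto simp: L_def)
  qed
  \<comment> \<open>The reverse inclusion is \<open>L_sub\<close> applied to the inverse scalar;
    this is where all nonzero scalars being units enters.\<close>
  have L_eq: "L (r \<odot>\<^bsub>M\<^esub> x) = L x" if x: "x \<in> carrier M" and r: "r \<in> carrier R - {\<zero>\<^bsub>R\<^esub>}" for r x
  proof
    show "L (r \<odot>\<^bsub>M\<^esub> x) \<subseteq> L x"
      using L_sub x r by blast
    have "r \<in> Units R"
      using r units by auto
    then have inv: "inv\<^bsub>R\<^esub> r \<in> carrier R" "inv\<^bsub>R\<^esub> r \<otimes>\<^bsub>R\<^esub> r = \<one>\<^bsub>R\<^esub>"
      by auto
    then have "inv\<^bsub>R\<^esub> r \<in> carrier R - {\<zero>\<^bsub>R\<^esub>}" "x = inv\<^bsub>R\<^esub> r \<odot>\<^bsub>M\<^esub> (r \<odot>\<^bsub>M\<^esub> x)"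
      using x r by (auto simp: smult_assoc1[symmetric])
    then show "L x \<subseteq> L (r \<odot>\<^bsub>M\<^esub> x)"
      using L_sub[of "r \<odot>\<^bsub>M\<^esub> x" "inv\<^bsub>R\<^esub> r"] x r by simp
  qed
  \<comment> \<open>The choice depends only on the set \<open>L y\<close>, so by \<open>L_eq\<close>
    all nonzero multiples of a vector share one representative.\<close>
  define P where "P y \<longleftrightarrow> y = (SOME z. z \<in> L y)" for y
  have "\<exists>r \<in> carrier R - {\<zero>\<^bsub>R\<^esub>}. \<exists>s \<in> carrier R - {\<zero>\<^bsub>R\<^esub>}. P (r \<odot>\<^bsub>M\<^esub> x) \<and> \<not> P (s \<odot>\<^bsub>M\<^esub> x)"
    if x: "x \<in> carrier M - {\<zero>\<^bsub>M\<^esub>}" for x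
  proof -
    have "\<one>\<^bsub>R\<^esub> \<odot>\<^bsub>M\<^esub> x \<in> L x"
      unfolding L_def using R.one_not_zero by blast
    then have "(SOME z. z \<in> L x) \<in> L x"
      by (rule someI)
    then obtain r where r: "r \<in> carrier R - {\<zero>\<^bsub>R\<^esub>}" "(SOME z. z \<in> L x) = r \<odot>\<^bsub>M\<^esub> x"
      by (auto simp: L_def)
    have rx: "P (r \<odot>\<^bsub>M\<^esub> x)"
      using L_eq[of x r] r x by (simp add: P_def)
    have tr: "t \<otimes>\<^bsub>R\<^esub> r \<in> carrier R - {\<zero>\<^bsub>R\<^esub>}"
      using t r by (auto simp: R.integral_iff)
    \<comment> \<open>The second vector is \<open>t\<close> times the representative. If the two
      coincided, torsion-freeness and cancellation of \<open>r\<close> would give \<open>t\<close> =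
      1.\<close>
    have "(t \<otimes>\<^bsub>R\<^esub> r) \<odot>\<^bsub>M\<^esub> x \<noteq> r \<odot>\<^bsub>M\<^esub> x"
    proof
      assume "(t \<otimes>\<^bsub>R\<^esub> r) \<odot>\<^bsub>M\<^esub> x = r \<odot>\<^bsub>M\<^esub> x"
      then have "(t \<otimes>\<^bsub>R\<^esub> r \<ominus>\<^bsub>R\<^esub> r) \<odot>\<^bsub>M\<^esub> x = \<zero>\<^bsub>M\<^esub>"
        using t r x by (simp add: R.minus_eq smult_l_distr smult_l_minus M.r_neg)
      then have "t \<otimes>\<^bsub>R\<^esub> r = \<one>\<^bsub>R\<^esub> \<otimes>\<^bsub>R\<^esub> r"
        using free_module_torsion_free[OF assms(1) free, of x "t \<otimes>\<^bsub>R\<^esub> r \<ominus>\<^bsub>R\<^esub> r"] x t r by auto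
      then show False
        using t r R.m_rcancel[of r t "\<one>\<^bsub>R\<^esub>"] by auto
    qed
    then have "\<not> P ((t \<otimes>\<^bsub>R\<^esub> r) \<odot>\<^bsub>M\<^esub> x)"
      using L_eq[of x "t \<otimes>\<^bsub>R\<^esub> r"] r x tr by (simp add: P_def)
    then show ?thesis
      using r rx tr by blast
  qed
  then show ?thesis
    by blast
qed

section \<open>Assembling the colouring\<close>

theorem theorem5p4:
  fixes R :: "('a, 'm) ring_scheme" and M :: "('a, 'b, 'n) module_scheme"
  assumes "factorial_domain R"
    and "\<not> R \<simeq> ZFact 2"
    and "free_module R M"
  shows "\<exists>c \<in> carrier M \<rightarrow> {0, 1 :: nat}.
           (\<forall>x \<in> carrier M - {\<zero>\<^bsub>M\<^esub>}.
              \<not> monochromatic_off_zero M c {r \<odot>\<^bsub>M\<^esub> x | r. r \<in> carrier R}) \<and>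
           (\<forall>N. submodule N R M \<and> N \<noteq> {\<zero>\<^bsub>M\<^esub>} \<longrightarrow> \<not> monochromatic_off_zero M c N)"
proof -
  interpret R: factorial_domain R by fact
  interpret module R M using assms(3) by (simp add: free_module_def)
  \<comment> \<open>Both cases are brought to one form: a predicate taking both truth values on the
    nonzero scalar multiples of every nonzero vector.\<close>
  have "\<exists>P. \<forall>x \<in> carrier M - {\<zero>\<^bsub>M\<^esub>}.
    \<exists>r \<in> carrier R - {\<zero>\<^bsub>R\<^esub>}. \<exists>s \<in> carrier R - {\<zero>\<^bsub>R\<^esub>}. P (r \<odot>\<^bsub>M\<^esub> x) \<and> \<not> P (s \<odot>\<^bsub>M\<^esub> x)"
  proof (cases "carrier R - {\<zero>\<^bsub>R\<^esub>} \<subseteq> Units R")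
    case True
    then show ?thesis
      using coloring_of_field[OF R.domain_axioms assms(3)] assms(2) by blast
  next
    case False
    then obtain p where p: "p \<in> carrier R - {\<zero>\<^bsub>R\<^esub>}" "p \<notin> Units R"
      by blast
    obtain c :: "_ \<Rightarrow> nat"
      where c: "\<forall>x \<in> carrier M - {\<zero>\<^bsub>M\<^esub>}. even (c (p \<odot>\<^bsub>M\<^esub> x)) \<noteq> even (c x)"
      using coloring_of_nonunit[OF assms(1,3) p] by blast
    have one: "\<one>\<^bsub>R\<^esub> \<in> carrier R - {\<zero>\<^bsub>R\<^esub>}"
      by simp
    show ?thesis
    proof (intro exI[of _ "\<lambda>x. even (c x)"] ballI)
      fix x assume x: "x \<in> carrier M - {\<zero>\<^bsub>M\<^esub>}"
      then have "even (c (p \<odot>\<^bsub>M\<^esub> x)) \<noteq> even (c (\<one>\<^bsub>R\<^esub> \<odot>\<^bsub>M\<^esub> x))"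
        using c by simp
      then show "\<exists>r \<in> carrier R - {\<zero>\<^bsub>R\<^esub>}. \<exists>s \<in> carrier R - {\<zero>\<^bsub>R\<^esub>}.
          even (c (r \<odot>\<^bsub>M\<^esub> x)) \<and> \<not> even (c (s \<odot>\<^bsub>M\<^esub> x))"
        using p(1) one by blast
    qed
  qed
  then obtain P where P: "\<And>x. x \<in> carrier M - {\<zero>\<^bsub>M\<^esub>} \<Longrightarrow>
    \<exists>r \<in> carrier R - {\<zero>\<^bsub>R\<^esub>}. \<exists>s \<in> carrier R - {\<zero>\<^bsub>R\<^esub>}. P (r \<odot>\<^bsub>M\<^esub> x) \<and> \<not> P (s \<odot>\<^bsub>M\<^esub> x)"
    by blast
  define c where "c x = (if P x then 0 else 1 :: nat)" for x
  \<comment> \<open>Allowing any \<open>S\<close> that contains all multiples of \<open>x\<close>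
    handles cyclic submodules and arbitrary nonzero submodules at once.\<close>
  have main: "\<not> monochromatic_off_zero M c S"
    if x: "x \<in> carrier M - {\<zero>\<^bsub>M\<^esub>}" and S: "{r \<odot>\<^bsub>M\<^esub> x | r. r \<in> carrier R} \<subseteq> S" for x S
  proof
    assume "monochromatic_off_zero M c S"
    then obtain k where k: "\<And>y. y \<in> S - {\<zero>\<^bsub>M\<^esub>} \<Longrightarrow> c y = k"
      by (auto simp: monochromatic_off_zero_def)
    \<comment> \<open>Torsion-freeness keeps \<open>r x\<close> nonzero, so it is among the vectors
      that must have colour \<open>k\<close>.\<close>
    have "c (r \<odot>\<^bsub>M\<^esub> x) = k" if "r \<in> carrier R - {\<zero>\<^bsub>R\<^esub>}" for r
      using k S that x free_module_torsion_free[OF R.domain_axioms assms(3), of x r] by blast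
    then have "\<And>r s. r \<in> carrier R - {\<zero>\<^bsub>R\<^esub>} \<Longrightarrow> s \<in> carrier R - {\<zero>\<^bsub>R\<^esub>} \<Longrightarrow>
        c (r \<odot>\<^bsub>M\<^esub> x) = c (s \<odot>\<^bsub>M\<^esub> x)"
      by simp
    then show False
      using P[OF x] by (fastforce simp: c_def)
  qed
  show ?thesis
  proof (intro bexI[of _ c] conjI ballI allI impI)
    fix x assume "x \<in> carrier M - {\<zero>\<^bsub>M\<^esub>}"
    then show "\<not> monochromatic_off_zero M c {r \<odot>\<^bsub>M\<^esub> x | r. r \<in> carrier R}"
      using main by blast
  next
    fix N assume N: "submodule N R M \<and> N \<noteq> {\<zero>\<^bsub>M\<^esub>}"
    then obtain x where x: "x \<in> N" "x \<noteq> \<zero>\<^bsub>M\<^esub>"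
      using submoduleE(2) by blast
    have "{r \<odot>\<^bsub>M\<^esub> x | r. r \<in> carrier R} \<subseteq> N" "x \<in> carrier M - {\<zero>\<^bsub>M\<^esub>}"
      using N x submoduleE(1,4) by blast+
    then show "\<not> monochromatic_off_zero M c N"
      using main by blast
  qed (auto simp: c_def)
qed

end
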